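(* Let $s,y\in\mathbb R^n$ with $s\ne0$ and $s^Ty<0$, put $\kappa=-s^Ty>0$ and $\mathcal H_\kappa=\{v\in\mathbb R^n:s^Tv=\kappa\}$. Let $B\in\mathbb R^{n\times n}$ be symmetric positive definite and put $b=s^TBs$. Then $$\widetilde y^{\mathrm E}:=\widetilde y(I)=y-\frac{2s^Ty}{s^Ts}s=y+\frac{2\kappa}{\|s\|^2}s,$$ $$\widetilde y^{\mathrm H}:=\widetilde y(B^{-1})=y-\frac{2s^Ty}{s^TBs}Bs=y+\frac{2\kappa}{b}Bs.$$ Thus $\widetilde y^{\mathrm E}-y\in\operatorname{span}\{s\}$ and $\widetilde y^{\mathrm H}-y\in\operatorname{span}\{Bs\}$, and both vectors belong to $\mathcal H_\kappa$.
   Context: For a symmetric positive definite matrix $M\in\mathbb R^{n\times n}$, $\|u\|_M^2:=u^TMu$, and $\widetilde y(M)$ denotes the (unique) minimizer of $\frac12\|v-y\|_M^2$ over $v\in\mathcal H_\kappa$. $\|\cdot\|$ is the Euclidean norm. *)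

theory Defs
  imports "HOL-Analysis.Analysis"
begin

definition sym_pos_def :: "real ^ 'n ^ 'n \<Rightarrow> bool" where
  "sym_pos_def M \<longleftrightarrow> transpose M = M \<and> (\<forall>x. x \<noteq> 0 \<longrightarrow> x \<bullet> (M *v x) > 0)"

definition sq_norm_wrt :: "real ^ 'n ^ 'n \<Rightarrow> real ^ 'n \<Rightarrow> real" where
  "sq_norm_wrt M u = u \<bullet> (M *v u)"

definition secant_plane :: "real ^ 'n \<Rightarrow> real \<Rightarrow> (real ^ 'n) set" where
  "secant_plane s \<kappa> = {v. s \<bullet> v = \<kappa>}"

definition is_correction ::
    "real ^ 'n \<Rightarrow> real \<Rightarrow> real ^ 'n \<Rightarrow> real ^ 'n ^ 'n \<Rightarrow> real ^ 'n \<Rightarrow> bool" where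
  "is_correction s \<kappa> y M v \<longleftrightarrow>
     is_arg_min (\<lambda>w. 1 / 2 * sq_norm_wrt M (w - y)) (\<lambda>w. w \<in> secant_plane s \<kappa>) v"

text \<open>The vector written $\widetilde y(M)$; the description is meaningful only when the
  minimizer exists and is unique, as it does for symmetric positive definite M and nonzero s.\<close>

definition y_tilde ::
    "real ^ 'n \<Rightarrow> real \<Rightarrow> real ^ 'n \<Rightarrow> real ^ 'n ^ 'n \<Rightarrow> real ^ 'n" where
  "y_tilde s \<kappa> y M = (THE v. is_correction s \<kappa> y M v)"

end

theory Submission
  imports Defs
begin

text \<open>If \<open>M d = s\<close>, the point \<open>p\<close> of the plane \<open>s \<bullet> v = \<kappa>\<close> on the line \<open>y + \<real> d\<close> satisfies
  \<open>M (p - y) \<in> span {s}\<close>, so \<open>p - y\<close> is \<open>M\<close>-orthogonal to all directions of the plane, and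
  Pythagoras makes \<open>p\<close> the unique minimizer. The two formulas are the cases \<open>M = I\<close>, \<open>d = s\<close> and
  \<open>M = B\<inverse>\<close>, \<open>d = B s\<close>; the factor 2 arises because \<open>\<kappa> - s \<bullet> y = 2 \<kappa>\<close>.\<close>

lemma inner_sym_matrix:
  fixes M :: "real ^ 'n ^ 'n"
  assumes "transpose M = M"
  shows "x \<bullet> (M *v y) = (M *v x) \<bullet> y"
  by (metis assms dot_lmul_matrix transpose_matrix_vector)

text \<open>By symmetry of \<open>M\<close> the two mixed terms coincide; once they vanish, this is
  Pythagoras.\<close>

lemma sq_norm_wrt_add:
  assumes "transpose M = M"
  shows "sq_norm_wrt M (u + w) = sq_norm_wrt M u + 2 * (w \<bullet> (M *v u)) + sq_norm_wrt M w"
  using inner_sym_matrix[OF assms, of u w]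
  by (simp add: sq_norm_wrt_def matrix_vector_right_distrib inner_add_left inner_add_right
      inner_commute)

lemma sq_norm_wrt_pos: "sym_pos_def M \<Longrightarrow> u \<noteq> 0 \<Longrightarrow> sq_norm_wrt M u > 0"
  by (simp add: sym_pos_def_def sq_norm_wrt_def)

lemma sym_pos_def_mat_1: "sym_pos_def (mat 1)"
  by (simp add: sym_pos_def_def)

text \<open>The kernel is trivial: \<open>M *v x = 0\<close> would make the quadratic form vanish at
  \<open>x\<close>.\<close>

lemma sym_pos_def_invertible:
  assumes "sym_pos_def M"
  shows "invertible M"
proof -
  have "x = 0" if "M *v x = 0" for x
    using assms that by (force simp: sym_pos_def_def)
  then show ?thesis
    by (simp add: invertible_left_inverse matrix_left_invertible_ker)
qed

lemma matrix_inv: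
  fixes M :: "real ^ 'n ^ 'n"
  assumes "invertible M"
  shows "matrix_inv M ** M = mat 1" and "M ** matrix_inv M = mat 1"
  using assms unfolding invertible_def matrix_inv_def by (metis (mono_tags, lifting) someI_ex)+

lemma sym_pos_def_matrix_inv:
  assumes "sym_pos_def M"
  shows "sym_pos_def (matrix_inv M)"
proof -
  have sym: "transpose M = M"
    using assms by (simp add: sym_pos_def_def)
  have inv: "invertible M"
    by (rule sym_pos_def_invertible[OF assms])
  \<comment> \<open>Transposing \<open>M ** matrix_inv M = mat 1\<close> gives a left inverse of
    \<open>M\<close>, and this must agree with the right inverse
    \<open>matrix_inv M\<close>.\<close>
  have "transpose (matrix_inv M) ** M = mat 1"
    by (metis inv matrix_inv(2) matrix_transpose_mul sym transpose_mat)
  then have "transpose (matrix_inv M) = matrix_inv M"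
    by (metis inv matrix_inv(2) matrix_mul_assoc matrix_mul_lid matrix_mul_rid)
  moreover have "x \<bullet> (matrix_inv M *v x) > 0" if "x \<noteq> 0" for x
  proof -
    \<comment> \<open>Substituting \<open>x = M *v ?z\<close> turns the form of the inverse at
      \<open>x\<close> into the form of \<open>M\<close> at \<open>?z\<close>.\<close>
    let ?z = "matrix_inv M *v x"
    have x: "M *v ?z = x"
      by (simp add: matrix_vector_mul_assoc matrix_inv(2)[OF inv])
    then have "?z \<noteq> 0"
      using that by auto
    then have "?z \<bullet> (M *v ?z) > 0"
      using assms unfolding sym_pos_def_def by blast
    then show ?thesis
      by (simp only: x inner_commute)
  qed
  ultimately show ?thesis
    by (simp add: sym_pos_def_def)
qed

text \<open>The equivalence form delivers existence, uniqueness and the value of the minimizer at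
  once.\<close>

lemma is_correction_iff:
  assumes M: "sym_pos_def M" and "s \<noteq> 0" and d: "M *v d = s"
  shows "is_correction s \<kappa> y M v \<longleftrightarrow> v = y + ((\<kappa> - s \<bullet> y) / (s \<bullet> d)) *\<^sub>R d"
proof -
  define c where "c = (\<kappa> - s \<bullet> y) / (s \<bullet> d)"
  define p where "p = y + c *\<^sub>R d"
  have sym: "transpose M = M"
    using M by (simp add: sym_pos_def_def)
  have "d \<noteq> 0"
    using \<open>s \<noteq> 0\<close> d by auto
  \<comment> \<open>Since \<open>s = M *v d\<close>, this product is the squared
    \<open>M\<close>-norm of \<open>d\<close>; hence the denominator in \<open>c\<close> is
    nonzero.\<close>
  then have "s \<bullet> d > 0"
    using sq_norm_wrt_pos[OF M, of d] by (simp add: sq_norm_wrt_def d inner_commute)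
  then have p: "p \<in> secant_plane s \<kappa>"
    by (simp add: p_def c_def secant_plane_def inner_add_right)
  have pyth: "sq_norm_wrt M (w - y) = sq_norm_wrt M (p - y) + sq_norm_wrt M (w - p)"
    if w: "w \<in> secant_plane s \<kappa>" for w
  proof -
    have "(w - p) \<bullet> (M *v (p - y)) = c * ((w - p) \<bullet> s)"
      by (simp add: p_def matrix_vector_mult_scaleR d)
    \<comment> \<open>The difference of two points of the plane is orthogonal to its normal
      \<open>s\<close>.\<close>
    also have "\<dots> = 0"
      using w p by (simp add: secant_plane_def inner_diff_left inner_diff_right inner_commute)
    finally show ?thesis
      using sq_norm_wrt_add[OF sym, of "p - y" "w - p"] by simp
  qed
  have less: "sq_norm_wrt M (p - y) < sq_norm_wrt M (w - y)"
    if "w \<in> secant_plane s \<kappa>" "w \<noteq> p" for w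
    using pyth[OF that(1)] sq_norm_wrt_pos[OF M, of "w - p"] that(2) by simp
  then have "is_correction s \<kappa> y M p"
    using p by (fastforce simp: is_correction_def is_arg_min_def not_less)
  \<comment> \<open>A minimizer other than \<open>p\<close> would be strictly beaten by
    \<open>p\<close>, by \<open>less\<close>.\<close>
  moreover have "v = p" if "is_correction s \<kappa> y M v"
    using that p less[of v] by (auto simp: is_correction_def is_arg_min_def)
  ultimately show ?thesis
    unfolding p_def c_def by blast
qed

lemma y_tilde_eq:
  assumes "sym_pos_def M" and "s \<noteq> 0" and "M *v d = s"
  shows "y_tilde s \<kappa> y M = y + ((\<kappa> - s \<bullet> y) / (s \<bullet> d)) *\<^sub>R d"
  by (simp add: y_tilde_def is_correction_iff[OF assms])

text \<open>Feasibility is part of being a minimizer, so no computation with the formula is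
  needed.\<close>

lemma y_tilde_in_secant_plane:
  assumes "sym_pos_def M" and "s \<noteq> 0" and "M *v d = s"
  shows "y_tilde s \<kappa> y M \<in> secant_plane s \<kappa>"
proof -
  have "is_correction s \<kappa> y M (y_tilde s \<kappa> y M)"
    by (simp add: is_correction_iff[OF assms] y_tilde_eq[OF assms])
  then show ?thesis
    by (simp add: is_correction_def is_arg_min_def)
qed

theorem corollary5p2:
  fixes s y yE yH :: "real ^ 'n" and B :: "real ^ 'n ^ 'n" and \<kappa> b :: real
  assumes "s \<noteq> 0" and "s \<bullet> y < 0"
    and "\<kappa> = - (s \<bullet> y)"
    and "sym_pos_def B"
    and "b = s \<bullet> (B *v s)"
    and "yE = y_tilde s \<kappa> y (mat 1)"
    and "yH = y_tilde s \<kappa> y (matrix_inv B)"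
  shows "\<kappa> > 0 \<and>
    (\<exists>!v. is_correction s \<kappa> y (mat 1) v) \<and>
    yE = y - (2 * (s \<bullet> y) / (s \<bullet> s)) *\<^sub>R s \<and>
    yE = y + (2 * \<kappa> / (norm s)\<^sup>2) *\<^sub>R s \<and>
    (\<exists>!v. is_correction s \<kappa> y (matrix_inv B) v) \<and>
    yH = y - (2 * (s \<bullet> y) / (s \<bullet> (B *v s))) *\<^sub>R (B *v s) \<and>
    yH = y + (2 * \<kappa> / b) *\<^sub>R (B *v s) \<and>
    yE - y \<in> span {s} \<and>
    yH - y \<in> span {B *v s} \<and>
    yE \<in> secant_plane s \<kappa> \<and>
    yH \<in> secant_plane s \<kappa>"
proof -
  have "matrix_inv B *v (B *v s) = s"
    using matrix_inv(1)[OF sym_pos_def_invertible[OF assms(4)]]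
    by (simp add: matrix_vector_mul_assoc)
  note E = sym_pos_def_mat_1 assms(1) matrix_vector_mul_lid[of s]
    and H = sym_pos_def_matrix_inv[OF assms(4)] assms(1) this
  have k: "\<kappa> - s \<bullet> y = 2 * \<kappa>"
    using assms(3) by simp
  have yE: "yE = y + (2 * \<kappa> / (s \<bullet> s)) *\<^sub>R s"
    unfolding assms(6) y_tilde_eq[OF E] k ..
  \<comment> \<open>With \<open>d = B *v s\<close> the denominator \<open>s \<bullet> d\<close> is
    \<open>b\<close>.\<close>
  have yH: "yH = y + (2 * \<kappa> / b) *\<^sub>R (B *v s)"
    unfolding assms(7) y_tilde_eq[OF H] k assms(5) ..
  show ?thesis
  proof (intro conjI)
    show "\<kappa> > 0"
      using assms(2,3) by simp
    show "\<exists>!v. is_correction s \<kappa> y (mat 1) v" "\<exists>!v. is_correction s \<kappa> y (matrix_inv B) v"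
      by (simp_all add: is_correction_iff[OF E] is_correction_iff[OF H])
    show "yE = y - (2 * (s \<bullet> y) / (s \<bullet> s)) *\<^sub>R s"
      by (simp add: yE assms(3))
    show "yE = y + (2 * \<kappa> / (norm s)\<^sup>2) *\<^sub>R s"
      by (simp add: yE power2_norm_eq_inner)
    show "yH = y - (2 * (s \<bullet> y) / (s \<bullet> (B *v s))) *\<^sub>R (B *v s)"
      by (simp add: yH assms(3,5))
    show "yH = y + (2 * \<kappa> / b) *\<^sub>R (B *v s)"
      by (rule yH)
    show "yE - y \<in> span {s}" "yH - y \<in> span {B *v s}"
      by (simp_all add: yE yH span_base span_scale)
    show "yE \<in> secant_plane s \<kappa>" "yH \<in> secant_plane s \<kappa>"
      unfolding assms(6,7) by (rule y_tilde_in_secant_plane[OF E], rule y_tilde_in_secant_plane[OF H])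
  qed
qed

end
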